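(* Let $X$ and $Y$ be two real Banach spaces, let $J$ be a connected topological space, and let $\{\Omega(s):X\times Y\to\mathbb R\}_{s\in J}$ be a continuous family of bounded non-degenerate bilinear forms (i.e. $s\mapsto L_{\Omega(s)}\in\mathcal B(X,Y^* )$ is norm continuous). Let $\{T(s):X\leadsto Y\}_{s\in J}$ be a continuous family of linear Fredholm relations with index $0$ such that $T(s)$ is skew-adjoint with respect to $\Omega(s)$ for each $s\in J$. Then $\dim\ker T(s)\bmod 2\in\mathbb Z_2$ is constant for $s\in J$.
   Context: A bilinear form $\Omega:X\times Y\to\mathbb R$ is non-degenerate if $\Omega(x,\cdot)=0$ implies $x=0$ and $\Omega(\cdot,y)=0$ implies $y=0$. If $\Omega$ is bounded, $L_\Omega:X\to Y^*$ is the bounded linear map $(L_\Omega x)(y)=\Omega(x,y)$. A linear relation $A:X\leadsto Y$ is a linear subspace $A\subset X\times Y$; $\ker A=\{x:(x,0)\in A\}$, $\operatorname{im}A=\{y:\exists x,\ (x,y)\in A\}$. A closed linear relation $A$ (closed in $X\times Y$) is Fredholm if $\dim\ker A<\infty$, $\operatorname{im}A$ is closed and $\dim Y/\operatorname{im}A<\infty$; then its index is $\dim\ker A-\dim Y/\operatorname{im}A$. The $\Omega$-adjoint of $A$ is $A^\Omega:=\{(x',y')\in X\times Y:\ \Omega(x,y')=\Omega(x',y)\ \forall (x,y)\in A\}$. $A$ is skew-adjoint with respect to $\Omega$ if $\{(x,-y):(x,y)\in A\}=A^\Omega$. A family of closed relations is continuous if it is continuous for the gap topology on closed subspaces of $X\times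 Y$, i.e. the topology defined by $\hat\delta(M,N)=\max\{\delta(M,N),\delta(N,M)\}$, $\delta(M,N)=\sup_{u\in M,\|u\|=1}\operatorname{dist}(u,N)$ ($=0$ if $M=\{0\}$). *)

theory Defs
  imports "HOL-Analysis.Analysis"
begin

section \<open>Bilinear forms\<close>

definition nondegenerate :: "('a::real_vector \<Rightarrow> 'b::real_vector \<Rightarrow> real) \<Rightarrow> bool" where
  "nondegenerate \<Omega> \<longleftrightarrow>
     (\<forall>x. (\<forall>y. \<Omega> x y = 0) \<longrightarrow> x = 0) \<and> (\<forall>y. (\<forall>x. \<Omega> x y = 0) \<longrightarrow> y = 0)"

text \<open>Meaningful only for bounded \<open>\<Omega>\<close>; see \<open>form_map_apply\<close>.\<close>

definition form_map ::
    "('a::real_normed_vector \<Rightarrow> 'b::real_normed_vector \<Rightarrow> real) \<Rightarrow> 'a \<Rightarrow>\<^sub>L 'b \<Rightarrow>\<^sub>L real" where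
  "form_map \<Omega> = Blinfun (\<lambda>x. Blinfun (\<Omega> x))"

lemma form_map_apply:
  assumes "bounded_bilinear \<Omega>"
  shows "blinfun_apply (blinfun_apply (form_map \<Omega>) x) y = \<Omega> x y"
proof -
  interpret bounded_bilinear \<Omega> by fact
  have r: "blinfun_apply (Blinfun (\<Omega> x)) = \<Omega> x" for x
    by (simp add: bounded_linear_Blinfun_apply bounded_linear_right)
  obtain K where K: "\<And>a b. norm (\<Omega> a b) \<le> norm a * norm b * K" "0 \<le> K"
    using nonneg_bounded by blast
  have "bounded_linear (\<lambda>x. Blinfun (\<Omega> x))"
  proof (rule bounded_linear_intro[where K = K])
    show "Blinfun (\<Omega> (u + v)) = Blinfun (\<Omega> u) + Blinfun (\<Omega> v)" for u v
      by (rule blinfun_eqI) (simp add: r blinfun.add_left add_left)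
    show "Blinfun (\<Omega> (c *\<^sub>R u)) = c *\<^sub>R Blinfun (\<Omega> u)" for c u
      by (rule blinfun_eqI) (simp add: r blinfun.scaleR_left scaleR_left)
    show "norm (Blinfun (\<Omega> u)) \<le> norm u * K" for u
      using K(1)[of u] K(2) by (intro norm_blinfun_bound) (auto simp: r mult_ac)
  qed
  then show ?thesis
    by (simp add: form_map_def bounded_linear_Blinfun_apply r)
qed

section \<open>Quotients of vector spaces\<close>

definition quot_class :: "'b::real_vector set \<Rightarrow> 'b \<Rightarrow> 'b set" where
  "quot_class W y = (\<lambda>w. y + w) ` W"

definition quot_space :: "'b::real_vector set \<Rightarrow> 'b set set" where
  "quot_space W = range (quot_class W)"

text \<open>
  The classes of the elements of \<open>B\<close> are pairwise distinct and form a finite basis of the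
  quotient by the subspace \<open>W\<close>: by definition of the vector space structure on the quotient,
  the linear combination of the classes of the \<open>b\<close> with coefficients \<open>u b\<close> is the class of
  \<open>\<Sum>b\<in>B. u b *\<^sub>R b\<close>, and its zero vector is the class of \<open>0\<close>.
\<close>

definition quot_basis :: "'b::real_vector set \<Rightarrow> 'b set \<Rightarrow> bool" where
  "quot_basis W B \<longleftrightarrow> finite B \<and>
     (\<forall>u. quot_class W (\<Sum>b\<in>B. u b *\<^sub>R b) = quot_class W 0 \<longrightarrow> (\<forall>b\<in>B. u b = 0)) \<and>
     (\<forall>K\<in>quot_space W. \<exists>u. K = quot_class W (\<Sum>b\<in>B. u b *\<^sub>R b))"

definition quot_findim :: "'b::real_vector set \<Rightarrow> bool" where
  "quot_findim W \<longleftrightarrow> (\<exists>B. quot_basis W B)"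

definition quot_dim :: "'b::real_vector set \<Rightarrow> nat" where
  "quot_dim W = card (SOME B. quot_basis W B)"

section \<open>Linear relations\<close>

text \<open>
  A linear relation is a subspace of the product space; the image of a relation is its \<open>Range\<close>.
\<close>

definition ker_rel :: "('a::real_vector \<times> 'b::real_vector) set \<Rightarrow> 'a set" where
  "ker_rel A = {x. (x, 0) \<in> A}"

definition fredholm_rel ::
    "('a::real_normed_vector \<times> 'b::real_normed_vector) set \<Rightarrow> bool" where
  "fredholm_rel A \<longleftrightarrow> subspace A \<and> closed A \<and>
     (\<exists>B. finite B \<and> span B = ker_rel A) \<and> closed (Range A) \<and> quot_findim (Range A)"

definition fredholm_index :: "('a::real_vector \<times> 'b::real_vector) set \<Rightarrow> int" where
  "fredholm_index A = int (dim (ker_rel A)) - int (quot_dim (Range A))"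

definition form_adjoint ::
    "('a \<Rightarrow> 'b \<Rightarrow> real) \<Rightarrow> ('a \<times> 'b) set \<Rightarrow> ('a \<times> 'b) set" where
  "form_adjoint \<Omega> A = {(x', y'). \<forall>(x, y)\<in>A. \<Omega> x y' = \<Omega> x' y}"

definition skew_adjoint_rel ::
    "('a \<Rightarrow> 'b::real_vector \<Rightarrow> real) \<Rightarrow> ('a \<times> 'b) set \<Rightarrow> bool" where
  "skew_adjoint_rel \<Omega> A \<longleftrightarrow> {(x, - y) |x y. (x, y) \<in> A} = form_adjoint \<Omega> A"

section \<open>The gap topology\<close>

definition gap_delta :: "'c::real_normed_vector set \<Rightarrow> 'c set \<Rightarrow> real" where
  "gap_delta M N = (if M = {0} then 0 else (SUP u\<in>{u\<in>M. norm u = 1}. infdist u N))"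

definition gap :: "'c::real_normed_vector set \<Rightarrow> 'c set \<Rightarrow> real" where
  "gap M N = max (gap_delta M N) (gap_delta N M)"

text \<open>
  The gap need not satisfy the triangle inequality, but it is equivalent to a metric, and a set of
  closed subspaces is open iff it contains a gap ball around each of its members. Passing to an
  equivalent norm (e.g. on a product) does not change this topology.
\<close>

definition gap_open :: "'c::real_normed_vector set set \<Rightarrow> bool" where
  "gap_open U \<longleftrightarrow> U \<subseteq> {M. subspace M \<and> closed M} \<and>
     (\<forall>M\<in>U. \<exists>r>0. \<forall>N. subspace N \<and> closed N \<and> gap M N < r \<longrightarrow> N \<in> U)"

definition gap_topology :: "'c::real_normed_vector set topology" where
  "gap_topology = topology gap_open"

lemma gap_openD:
  assumes "gap_open U" "M \<in> U"
  shows "\<exists>r>0. \<forall>N. subspace N \<and> closed N \<and> gap M N < r \<longrightarrow> N \<in> U"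
  using assms by (simp add: gap_open_def)

lemma istopology_gap_open: "istopology (gap_open :: 'c::real_normed_vector set set \<Rightarrow> bool)"
  unfolding istopology_def
proof (intro conjI allI impI)
  fix S T :: "'c set set"
  assume S: "gap_open S" and T: "gap_open T"
  show "gap_open (S \<inter> T)"
    unfolding gap_open_def
  proof (intro conjI ballI)
    show "S \<inter> T \<subseteq> {M. subspace M \<and> closed M}"
      using S by (auto simp: gap_open_def)
    fix M assume "M \<in> S \<inter> T"
    then have "M \<in> S" "M \<in> T" by auto
    obtain r where r: "r > 0" "\<forall>N. subspace N \<and> closed N \<and> gap M N < r \<longrightarrow> N \<in> S"
      using gap_openD[OF S \<open>M \<in> S\<close>] by (elim exE conjE)
    obtain r' where r': "r' > 0" "\<forall>N. subspace N \<and> closed N \<and> gap M N < r' \<longrightarrow> N \<in> T"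
      using gap_openD[OF T \<open>M \<in> T\<close>] by (elim exE conjE)
    show "\<exists>r>0. \<forall>N. subspace N \<and> closed N \<and> gap M N < r \<longrightarrow> N \<in> S \<inter> T"
      by (rule exI[of _ "min r r'"]) (use r r' in simp)
  qed
next
  fix K :: "'c set set set"
  assume K: "\<forall>S\<in>K. gap_open S"
  show "gap_open (\<Union>K)"
    unfolding gap_open_def
  proof (intro conjI ballI)
    show "\<Union>K \<subseteq> {M. subspace M \<and> closed M}"
      using K by (simp add: gap_open_def Union_least)
    fix M assume "M \<in> \<Union>K"
    then obtain S where "S \<in> K" "M \<in> S" by (rule UnionE)
    obtain r where "r > 0" "\<forall>N. subspace N \<and> closed N \<and> gap M N < r \<longrightarrow> N \<in> S"
      using gap_openD[OF bspec[OF K \<open>S \<in> K\<close>] \<open>M \<in> S\<close>] by (elim exE conjE)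
    then show "\<exists>r>0. \<forall>N. subspace N \<and> closed N \<and> gap M N < r \<longrightarrow> N \<in> \<Union>K"
      using \<open>S \<in> K\<close> by (metis UnionI)
  qed
qed

lemma openin_gap_topology: "openin gap_topology U \<longleftrightarrow> gap_open U"
  by (simp add: gap_topology_def istopology_gap_open)

lemma topspace_gap_topology:
  "topspace (gap_topology :: 'c::real_normed_vector set topology) = {M. subspace M \<and> closed M}"
proof -
  have 1: "gap_open {M :: 'c set. subspace M \<and> closed M}"
    unfolding gap_open_def by (simp add: gt_ex)
  have 2: "U \<subseteq> {M. subspace M \<and> closed M}" if "gap_open U" for U :: "'c set set"
    using that by (simp add: gap_open_def)
  show ?thesis
    unfolding topspace_def openin_gap_topology
    by (rule antisym; rule Union_least Union_upper; use 1 2 in simp)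
qed

end

theory Submission
  imports Defs
begin

text \<open>
  The parity is locally constant by a finite-dimensional reduction. Fix \<open>A = T s\<close> with kernel of
  dimension \<open>n\<close>. Index \<open>0\<close> and skew-adjointness make the range of \<open>A\<close> the annihilator of its kernel,
  so there is a complement \<open>V\<close> of the range in perfect duality with the kernel. For a relation \<open>N\<close>
  near \<open>A\<close> in the gap, the space \<open>E = {(x, y) \<in> N. y \<in> V}\<close> still has dimension \<open>n\<close>: this is a
  perturbation argument resting on the open mapping theorem. On \<open>N\<close>, the form
  \<open>((x, y), (x', y')) \<mapsto> \<Omega> x y'\<close> is skew-symmetric, and the radical of its restriction to \<open>E\<close> is
  the kernel of \<open>N\<close>. A skew-symmetric form has even rank, so \<open>n\<close> and the dimension of the kernel
  of \<open>N\<close> have the same parity.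
\<close>

section \<open>Linear algebra\<close>


text \<open>A basis of \<open>E\<close> is carried to a basis of the image with the same
  \<open>card\<close>. If the basis is infinite, both dimensions are 0, so this case is covered as
  well.\<close>

lemma dim_injective_image:
  fixes f :: "'a::real_vector \<Rightarrow> 'b::real_vector"
  assumes "linear f" "subspace E" "inj_on f E"
  shows "dim (f ` E) = dim E"
proof -
  obtain B where B: "B \<subseteq> E" "independent B" "E \<subseteq> span B" "card B = dim E"
    using basis_exists by blast
  have E: "span B = E"
    using B assms(2) by (simp add: span_minimal subset_antisym)
  have "dim (f ` E) = card (f ` B)"
  proof (rule dim_unique[OF _ _ _ refl])
    show "f ` B \<subseteq> f ` E" using B by blast
    show "f ` E \<subseteq> span (f ` B)"
      using E linear_span_image[OF assms(1), of B] by simp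
    show "independent (f ` B)"
      using linear_independent_injective_image[OF assms(1) B(2)] assms(3) E by simp
  qed
  moreover have "card (f ` B) = card B"
    using assms(3) B(1) by (meson card_image inj_on_subset)
  ultimately show ?thesis using B by simp
qed

text \<open>A form that does not vanish on \<open>E\<close> has a hyperbolic plane there. The
  orthogonal complement of the plane in \<open>E\<close> has dimension smaller by 2 and the same
  radical, so induction on \<open>dim E\<close> applies.\<close>

lemma skew_form_corank_even:
  fixes b :: "'a::real_vector \<Rightarrow> 'a \<Rightarrow> real"
  assumes b: "bilinear b" and "subspace E" and "finite B" "E \<subseteq> span B"
    and "\<And>u v. u \<in> E \<Longrightarrow> v \<in> E \<Longrightarrow> b u v = - b v u"
  shows "\<exists>k. dim E = dim {u\<in>E. \<forall>v\<in>E. b u v = 0} + 2 * k"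
  using assms(2,4,5)
proof (induction "dim E" arbitrary: E rule: less_induct)
  case less
  note skew = less.prems(3)
  have lin: "b (x + y) z = b x z + b y z" "b (x - y) z = b x z - b y z" "b (c *\<^sub>R x) z = c * b x z"
    "b z (x + y) = b z x + b z y" "b z (x - y) = b z x - b z y" "b z (c *\<^sub>R x) = c * b z x" for x y z c
    using b by (simp_all add: bilinear_ladd bilinear_lsub bilinear_lmul bilinear_radd bilinear_rsub bilinear_rmul)
  show ?case
  proof (cases "\<forall>u\<in>E. \<forall>v\<in>E. b u v = 0")
    case True
    then have "{u\<in>E. \<forall>v\<in>E. b u v = 0} = E" by blast
    then show ?thesis by (intro exI[of _ 0]) simp
  next
    case False
    then obtain u v0 where u: "u \<in> E" "v0 \<in> E" "b u v0 \<noteq> 0" by blast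
    define v where "v = (1 / b u v0) *\<^sub>R v0"
    have v: "v \<in> E" "b u v = 1"
      using u less.prems(1) by (auto simp: v_def lin subspace_scale)
    have vu: "b v u = -1" using skew[OF v(1) u(1)] v by simp
    have self: "b w w = 0" if "w \<in> E" for w using skew[OF that that] by simp
    \<comment> \<open>Split off the hyperbolic plane spanned by \<open>u\<close> and \<open>v\<close>.\<close>
    define E' where "E' = {w\<in>E. b u w = 0 \<and> b v w = 0}"
    have sE': "subspace E'"
      using less.prems(1) bilinear_rzero[OF b]
      by (auto simp: E'_def subspace_def lin)
    have E'E: "E' \<subseteq> E" by (auto simp: E'_def)
    obtain C where C: "C \<subseteq> E'" "independent C" "E' \<subseteq> span C" "card C = dim E'"
      using basis_exists by blast
    have spC: "span C = E'"
      using C sE' by (simp add: span_minimal subset_antisym)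
    \<comment> \<open>Projection to \<open>E'\<close> along the plane; the coefficients are forced
      by \<open>b u v = 1\<close>, \<open>b v u = -1\<close> and the vanishing of
      \<open>b u u\<close> and \<open>b v v\<close>.\<close>
    have decomp: "w - b u w *\<^sub>R v - b w v *\<^sub>R u \<in> E'" if "w \<in> E" for w
      using that u v vu self skew[of v w] less.prems(1)
      by (auto simp: E'_def lin intro!: subspace_diff subspace_scale)
    have vC: "v \<notin> span C" unfolding spC using v by (simp add: E'_def)
    have uC: "u \<notin> span (insert v C)"
    proof
      assume "u \<in> span (insert v C)"
      then obtain k where k: "u - k *\<^sub>R v \<in> E'"
        using spC by (auto simp: span_breakdown_eq)
      then have "b u (u - k *\<^sub>R v) = 0" "b v (u - k *\<^sub>R v) = 0" by (simp_all add: E'_def)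
      then show False using self u v vu by (simp add: lin)
    qed
    have ind: "independent (insert u (insert v C))"
      using uC vC C by (simp add: independent_insert)
    have sub: "insert u (insert v C) \<subseteq> E" using u v C E'E by blast
    \<comment> \<open>Finiteness matters: \<open>card\<close> of an infinite set is 0, and the count
      below would not gain 2.\<close>
    have fin: "finite (insert u (insert v C))"
      using independent_span_bound[OF assms(3) ind subset_trans[OF sub less.prems(2)]] by simp
    have "E \<subseteq> span (insert u (insert v C))"
    proof
      fix w assume "w \<in> E"
      from decomp[OF this] have "w - b w v *\<^sub>R u - b u w *\<^sub>R v \<in> span C"
        by (simp add: spC algebra_simps)
      then show "w \<in> span (insert u (insert v C))"
        by (auto simp: span_breakdown_eq)
    qed
    then have "dim E = card (insert u (insert v C))"
      using sub ind by (intro dim_unique) auto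
    also have "\<dots> = dim E' + 2"
    proof -
      have "v \<notin> C" "u \<notin> insert v C"
        using uC vC span_base[of v C] span_base[of u "insert v C"] by auto
      then show ?thesis using fin C(4) by simp
    qed
    finally have dE: "dim E = dim E' + 2" .
    have "\<exists>k. dim E' = dim {u\<in>E'. \<forall>v\<in>E'. b u v = 0} + 2 * k"
      using less.prems E'E dE sE' by (intro less.hyps) auto
    \<comment> \<open>Membership in \<open>E'\<close> is orthogonality to \<open>u\<close> and
      \<open>v\<close>. Together with orthogonality to \<open>E'\<close> it gives, through
      \<open>decomp\<close>, orthogonality to all of \<open>E\<close>.\<close>
    moreover have "{u\<in>E'. \<forall>v\<in>E'. b u v = 0} = {u\<in>E. \<forall>v\<in>E. b u v = 0}"
    proof (intro set_eqI iffI)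
      fix r assume r: "r \<in> {u\<in>E'. \<forall>v\<in>E'. b u v = 0}"
      then have "r \<in> E" using E'E by blast
      moreover have "b r w = 0" if "w \<in> E" for w
      proof -
        have "b r (w - b u w *\<^sub>R v - b w v *\<^sub>R u) = 0" using decomp[OF that] r by blast
        moreover have "b r u = 0" "b r v = 0"
          using r skew[OF \<open>r \<in> E\<close> u(1)] skew[OF \<open>r \<in> E\<close> v(1)] by (auto simp: E'_def)
        ultimately show ?thesis by (simp add: lin)
      qed
      ultimately show "r \<in> {u\<in>E. \<forall>v\<in>E. b u v = 0}" by blast
    next
      fix r assume r: "r \<in> {u\<in>E. \<forall>v\<in>E. b u v = 0}"
      then have "b u r = 0" "b v r = 0"
        using skew[of u r] skew[of v r] u v by auto
      then show "r \<in> {u\<in>E'. \<forall>v\<in>E'. b u v = 0}"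
        using r E'E by (auto simp: E'_def)
    qed
    ultimately obtain k where "dim E' = dim {u\<in>E. \<forall>v\<in>E. b u v = 0} + 2 * k" by auto
    then show ?thesis using dE by (intro exI[of _ "Suc k"]) simp
  qed
qed

text \<open>Since \<open>V\<close> separates the points of \<open>span I\<close>, no functional
  \<open>f a\<close> is on \<open>V\<close> a combination of the other \<open>f i\<close>. Hence
  some element of \<open>V\<close> is killed by the other \<open>i\<close> but not by
  \<open>a\<close>, and the family can be extended by it.\<close>

lemma dual_family_exists:
  fixes f :: "'a::real_vector \<Rightarrow> 'b::real_vector \<Rightarrow> real"
  assumes f: "bilinear f" and V: "subspace V" and "finite I" "independent I"
    and "\<And>x. x \<in> span I \<Longrightarrow> \<forall>y\<in>V. f x y = 0 \<Longrightarrow> x = 0"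
  shows "\<exists>v. (\<forall>i\<in>I. v i \<in> V) \<and> (\<forall>i\<in>I. \<forall>j\<in>I. f i (v j) = (if i = j then 1 else 0))"
  using assms(3-)
proof (induction I)
  case empty
  then show ?case by simp
next
  case (insert a I)
  have lin: "f (x + y) z = f x z + f y z" "f (x - y) z = f x z - f y z" "f (c *\<^sub>R x) z = c * f x z"
    "f t (x' + y') = f t x' + f t y'" "f t (x' - y') = f t x' - f t y'" "f t (c *\<^sub>R x') = c * f t x'"
    for x y z c t x' y'
    using f by (simp_all add: bilinear_ladd bilinear_lsub bilinear_lmul bilinear_radd bilinear_rsub bilinear_rmul)
  have suml: "f (\<Sum>i\<in>I. c i *\<^sub>R i) z = (\<Sum>i\<in>I. c i * f i z)" for c z
    using f linear_sum[of "\<lambda>x. f x z" "\<lambda>i. c i *\<^sub>R i" I] lin(3) by (simp add: bilinear_def)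
  have sumr: "f z (\<Sum>i\<in>I. c i *\<^sub>R g i) = (\<Sum>i\<in>I. c i * f z (g i))" for c z g
    using f linear_sum[of "f z" "\<lambda>i. c i *\<^sub>R g i" I] lin(6) by (simp add: bilinear_def)
  have ind: "independent I" "a \<notin> span I"
    using insert.prems(1) insert.hyps by (auto simp: independent_insert)
  have "\<exists>v. (\<forall>i\<in>I. v i \<in> V) \<and> (\<forall>i\<in>I. \<forall>j\<in>I. f i (v j) = (if i = j then 1 else 0))"
    using insert.prems(2) span_mono[OF subset_insertI, of I a] ind(1) by (intro insert.IH) auto
  then obtain v where v: "\<And>i. i \<in> I \<Longrightarrow> v i \<in> V"
    "\<And>i j. i \<in> I \<Longrightarrow> j \<in> I \<Longrightarrow> f i (v j) = (if i = j then 1 else 0)" by blast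
  have "\<exists>y\<in>V. (\<forall>i\<in>I. f i y = 0) \<and> f a y \<noteq> 0"
  proof (rule ccontr)
    assume neg: "\<not> ?thesis"
    \<comment> \<open>If \<open>f a\<close> vanished on every element of \<open>V\<close> killed by
      \<open>I\<close>, it would agree on \<open>V\<close> with the combination of the
      \<open>f i\<close> with coefficients \<open>f a (v i)\<close>. Then \<open>z\<close> pairs to
      zero with \<open>V\<close>, so \<open>z = 0\<close> and \<open>a\<close> lies in
      \<open>span I\<close>.\<close>
    define z where "z = a - (\<Sum>i\<in>I. f a (v i) *\<^sub>R i)"
    have "f z y = 0" if "y \<in> V" for y
    proof -
      define y' where "y' = y - (\<Sum>i\<in>I. f i y *\<^sub>R v i)"
      have "y' \<in> V" using that v V
        by (auto simp: y'_def intro!: subspace_diff subspace_sum subspace_scale)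
      moreover have "f j y' = 0" if "j \<in> I" for j
        using that insert.hyps
        by (simp add: y'_def lin sumr v if_distrib[of "\<lambda>t. _ * t"] sum.delta' cong: if_cong)
      ultimately have "f a y' = 0" using neg by blast
      then show ?thesis by (simp add: z_def y'_def lin suml sumr mult.commute)
    qed
    moreover have "(\<Sum>i\<in>I. f a (v i) *\<^sub>R i) \<in> span I"
      by (intro span_sum span_scale span_base)
    moreover from this have "z \<in> span (insert a I)"
      unfolding z_def span_breakdown_eq by (intro exI[of _ 1]) (simp add: span_neg)
    ultimately have "z = 0" using insert.prems(2) by blast
    then show False using ind \<open>(\<Sum>i\<in>I. f a (v i) *\<^sub>R i) \<in> span I\<close> by (simp add: z_def)
  qed
  then obtain y where y: "y \<in> V" "\<And>i. i \<in> I \<Longrightarrow> f i y = 0" "f a y \<noteq> 0" by blast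
  define va where "va = (1 / f a y) *\<^sub>R y"
  have va: "va \<in> V" "\<And>i. i \<in> I \<Longrightarrow> f i va = 0" "f a va = 1"
    using y V by (auto simp: va_def lin subspace_scale)
  \<comment> \<open>Subtracting a multiple of \<open>va\<close> removes the pairing with
    \<open>a\<close> and leaves the pairings with \<open>I\<close> unchanged, because
    \<open>I\<close> kills \<open>va\<close>.\<close>
  define w where "w i = (if i = a then va else v i - f a (v i) *\<^sub>R va)" for i
  have "\<forall>i\<in>insert a I. w i \<in> V"
    using va v V by (auto simp: w_def intro!: subspace_diff subspace_scale)
  moreover have "\<forall>i\<in>insert a I. \<forall>j\<in>insert a I. f i (w j) = (if i = j then 1 else 0)"
    using va v insert.hyps by (auto simp: w_def lin)
  ultimately show ?case by blast
qed


section \<open>Open mapping and perturbation in the gap topology\<close>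

text \<open>Correcting repeatedly halves the residual each time, so the corrections are dominated by
  a geometric series with sum \<open>2 * K * norm w\<close>. Completeness of the domain and
  closedness of \<open>M\<close> give a limit in \<open>M\<close>.\<close>

lemma approximate_preimage_imp_preimage:
  fixes S :: "'a::banach \<Rightarrow> 'b::real_normed_vector"
  assumes S: "bounded_linear S" and M: "subspace M" "closed M" and W: "subspace W" "S ` M \<subseteq> W"
    and approx: "\<And>w. w \<in> W \<Longrightarrow> \<exists>u\<in>M. norm u \<le> K * norm w \<and> norm (S u - w) \<le> norm w / 2"
    and w: "w \<in> W"
  shows "\<exists>u\<in>M. S u = w \<and> norm u \<le> 2 * K * norm w"
proof -
  interpret bounded_linear S by fact
  obtain g where g: "\<And>w. w \<in> W \<Longrightarrow> g w \<in> M" "\<And>w. w \<in> W \<Longrightarrow> norm (g w) \<le> K * norm w"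
    "\<And>w. w \<in> W \<Longrightarrow> norm (S (g w) - w) \<le> norm w / 2"
    using approx by metis
  \<comment> \<open>\<open>e n\<close> is the residual after \<open>n\<close> corrections; the next
    correction is \<open>g (e n)\<close>.\<close>
  define e where "e n = ((\<lambda>w. w - S (g w)) ^^ n) w" for n
  have e0: "e 0 = w" and eS: "e (Suc n) = e n - S (g (e n))" for n by (simp_all add: e_def)
  have eW: "e n \<in> W" for n
    by (induction n) (use w W g in \<open>auto simp: e0 eS intro!: subspace_diff\<close>)
  have en: "norm (e n) \<le> norm w * (1/2)^n" for n
  proof (induction n)
    case (Suc n)
    then show ?case using g(3)[OF eW[of n]] by (simp add: eS norm_minus_commute)
  qed (simp add: e0)
  define u where "u n = g (e n)" for n
  \<comment> \<open>The sign of \<open>K\<close> is not given. For \<open>w \<noteq> 0\<close> the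
    bound on \<open>g w\<close> forces \<open>K \<ge> 0\<close>; for \<open>w = 0\<close> all
    residuals vanish.\<close>
  have un: "norm (u n) \<le> (K * norm w) * (1/2)^n" for n
  proof (cases "w = 0")
    case True
    then have "e n = 0" using en[of n] by simp
    then show ?thesis using g(2)[OF eW[of n]] True by (simp add: u_def)
  next
    case False
    have "0 \<le> K * norm w" using order_trans[OF norm_ge_zero g(2)[OF w]] .
    then have "K \<ge> 0" using False by (simp add: zero_le_mult_iff)
    then show ?thesis
      using g(2)[OF eW[of n]] mult_left_mono[OF en[of n], of K] by (simp add: u_def algebra_simps)
  qed
  have sg: "summable (\<lambda>n. (K * norm w) * (1/2::real)^n)" by (simp add: summable_geometric)
  have sn: "summable (\<lambda>n. norm (u n))"
    by (rule summable_comparison_test'[OF sg, of 0]) (simp add: un)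
  have su: "summable u" using sn by (rule summable_norm_cancel)
  have "suminf u \<in> M"
  proof (rule Lim_in_closed_set[OF M(2) _ _ summable_LIMSEQ[OF su]])
    show "\<forall>\<^sub>F n in sequentially. (\<Sum>i<n. u i) \<in> M"
      using M g eW by (auto simp: u_def intro!: always_eventually subspace_sum)
  qed simp
  moreover have "norm (suminf u) \<le> 2 * K * norm w"
  proof -
    have "norm (suminf u) \<le> (\<Sum>n. norm (u n))" by (rule summable_norm[OF sn])
    also have "\<dots> \<le> (\<Sum>n. (K * norm w) * (1/2)^n)" by (rule suminf_le[OF un sn sg])
    also have "\<dots> = 2 * K * norm w"
      by (subst suminf_mult) (simp_all add: summable_geometric suminf_geometric)
    finally show ?thesis .
  qed
  moreover have "S (suminf u) = w"
  proof -
    have part: "(\<Sum>i<n. S (u i)) = w - e n" for n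
      by (induction n) (simp_all add: e0 eS u_def)
    have "e \<longlonglongrightarrow> 0"
    proof (rule Lim_null_comparison)
      show "\<forall>\<^sub>F n in sequentially. norm (e n) \<le> norm w * (1/2)^n" using en by simp
      show "(\<lambda>n. norm w * (1/2)^n) \<longlonglongrightarrow> 0"
        by (rule tendsto_mult_right_zero) (simp add: LIMSEQ_realpow_zero)
    qed
    then have "(\<lambda>n. \<Sum>i<n. S (u i)) \<longlonglongrightarrow> w - 0"
      unfolding part by (intro tendsto_intros)
    then have "(\<lambda>n. S (u n)) sums w" by (simp add: sums_def)
    then show ?thesis using suminf[OF su] sums_unique by metis
  qed
  ultimately show ?thesis by blast
qed

lemma open_mapping_subspace:
  fixes S :: "'a::banach \<Rightarrow> 'b::banach"
  assumes S: "bounded_linear S" and M: "subspace M" "closed M" and W: "closed (S ` M)"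
  shows "\<exists>C>0. \<forall>w\<in>S ` M. \<exists>u\<in>M. S u = w \<and> norm u \<le> C * norm w"
proof -
  interpret bounded_linear S by fact
  define W where "W = S ` M"
  have sW: "subspace W" unfolding W_def
    using M(1) linear_axioms by (rule linear_subspace_image[rotated])
  define F where "F k = closure (S ` (M \<inter> cball 0 (real k)))" for k
  have FW: "F k \<subseteq> W" for k
    unfolding F_def W_def by (rule closure_minimal) (use W in auto)
  have UF: "(\<Union>k. F k) = W"
  proof
    show "(\<Union>k. F k) \<subseteq> W" using FW by blast
    show "W \<subseteq> (\<Union>k. F k)"
    proof
      fix w assume "w \<in> W"
      then obtain u where u: "u \<in> M" "w = S u" by (auto simp: W_def)
      obtain k where "norm u \<le> real k" using real_arch_simple by blast
      then have "w \<in> F k" unfolding F_def using u closure_subset by fastforce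
      then show "w \<in> (\<Union>k. F k)" by blast
    qed
  qed
  \<comment> \<open>\<open>W\<close> is nonempty, complete and covered by the countably many closed
    sets \<open>F k\<close>, so one of them has interior points relative to
    \<open>W\<close>.\<close>
  have "\<exists>k. top_of_set W interior_of F k \<noteq> {}"
  proof (rule ccontr)
    assume "\<not> ?thesis"
    then have "top_of_set W interior_of \<Union>(range F) = {}"
    proof (intro Baire_category_alt disjI1 conjI)
      show "completely_metrizable_space (top_of_set W)"
        using W by (simp add: W_def completely_metrizable_space_closedin completely_metrizable_space_euclidean)
      show "closedin (top_of_set W) T" if "T \<in> range F" for T
        using that FW closed_subset[of _ W] by (auto simp: F_def)
    qed auto
    moreover have "top_of_set W interior_of \<Union>(range F) = W"
      unfolding UF using interior_of_topspace[of "top_of_set W"] by simp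
    ultimately show False using sW subspace_0 by blast
  qed
  then obtain k w0 where "w0 \<in> top_of_set W interior_of F k" by blast
  then obtain T where T: "openin (top_of_set W) T" "w0 \<in> T" "T \<subseteq> F k"
    by (auto simp: interior_of_def)
  then obtain d where d: "d > 0" "ball w0 d \<inter> W \<subseteq> F k" "w0 \<in> W"
    unfolding openin_contains_ball by (meson order_trans subsetD)
  \<comment> \<open>Both \<open>w0 + z\<close> and \<open>w0\<close> lie in \<open>F k\<close>.
    Subtracting their approximate preimages approximates \<open>z\<close>, at the price of doubling
    the norm bound.\<close>
  have near: "\<exists>u\<in>M. norm u \<le> 2 * real k \<and> norm (S u - z) < e" if z: "z \<in> W" "norm z < d" and e: "e > 0" for z e
  proof -
    have "w0 + z \<in> F k" "w0 \<in> F k"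
      using d z sW by (auto intro!: subsetD[OF d(2)] simp: dist_norm subspace_add)
    then obtain a b where a: "a \<in> S ` (M \<inter> cball 0 (real k))" "dist a (w0 + z) < e/2"
      and b: "b \<in> S ` (M \<inter> cball 0 (real k))" "dist b w0 < e/2"
      using e unfolding F_def closure_approachable by (meson half_gt_zero)
    then obtain u v where u: "u \<in> M" "norm u \<le> real k" "a = S u" and v: "v \<in> M" "norm v \<le> real k" "b = S v"
      by auto
    have "norm (u - v) \<le> 2 * real k" using norm_triangle_ineq4[of u v] u v by linarith
    moreover have "norm (S (u - v) - z) < e"
    proof -
      have "S (u - v) - z = (a - (w0 + z)) - (b - w0)" using u v by (simp add: diff)
      then have "norm (S (u - v) - z) \<le> dist a (w0 + z) + dist b w0"
        using norm_triangle_ineq4[of "a - (w0 + z)" "b - w0"] by (simp only: dist_norm)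
      then show ?thesis using a b by linarith
    qed
    ultimately show ?thesis using u v M by (meson subspace_diff)
  qed
  \<comment> \<open>Scaling \<open>w\<close> to norm \<open>d/2\<close>, approximating up to
    \<open>d/4\<close> and scaling back multiplies \<open>2 * real k\<close> by
    \<open>2 * norm w / d\<close>, and leaves the error \<open>norm w / 2\<close>.\<close>
  define K where "K = 4 * real k / d"
  have approx: "\<exists>u\<in>M. norm u \<le> K * norm w \<and> norm (S u - w) \<le> norm w / 2" if w: "w \<in> W" for w
  proof (cases "w = 0")
    case True
    then show ?thesis using M by (intro bexI[of _ 0]) (auto simp: subspace_0 zero)
  next
    case False
    define t where "t = d / (2 * norm w)"
    have t: "t > 0" using d False by (simp add: t_def)
    have "t *\<^sub>R w \<in> W" "norm (t *\<^sub>R w) < d"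
      using w sW d False by (auto simp: subspace_scale t_def)
    from near[OF this, of "d/4"] d obtain u where u: "u \<in> M" "norm u \<le> 2 * real k" "norm (S u - t *\<^sub>R w) < d/4"
      by auto
    have "norm ((1/t) *\<^sub>R u) = norm u / t" using t by simp
    also have "\<dots> \<le> 2 * real k / t" using u t by (simp add: divide_right_mono)
    also have "\<dots> = K * norm w" using d False by (simp add: t_def K_def)
    finally have 1: "norm ((1/t) *\<^sub>R u) \<le> K * norm w" .
    have "S ((1/t) *\<^sub>R u) - w = (1/t) *\<^sub>R (S u - t *\<^sub>R w)" using t by (simp add: scaleR algebra_simps)
    then have "norm (S ((1/t) *\<^sub>R u) - w) = norm (S u - t *\<^sub>R w) / t" using t by simp
    also have "\<dots> \<le> (d/4) / t" using u t by (intro divide_right_mono) auto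
    also have "\<dots> = norm w / 2" using d False by (simp add: t_def)
    finally show ?thesis using 1 u M by (meson subspace_scale)
  qed
  \<comment> \<open>The summand 1 makes the constant positive even if \<open>k = 0\<close>.\<close>
  have "\<exists>u\<in>M. S u = w \<and> norm u \<le> (2 * K + 1) * norm w" if "w \<in> W" for w
  proof -
    obtain u where "u \<in> M" "S u = w" "norm u \<le> 2 * K * norm w"
      using approximate_preimage_imp_preimage[OF S M sW _ approx \<open>w \<in> W\<close>] by (auto simp: W_def)
    moreover have "2 * K * norm w \<le> (2 * K + 1) * norm w" by (simp add: distrib_right)
    ultimately show ?thesis by (intro bexI[of _ u]) auto
  qed
  moreover have "2 * K + 1 > 0" using d by (simp add: K_def add_nonneg_pos)
  ultimately show ?thesis unfolding W_def by blast
qed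

section \<open>Approximation of vectors and neighbourhoods in the gap\<close>

text \<open>Scaling passes from unit vectors to all of \<open>M\<close>. The strict inequality
  provides an actual vector of \<open>N\<close>, although the distance to \<open>N\<close> may not
  be attained.\<close>

lemma gap_delta_approx:
  assumes M: "subspace M" and N: "subspace N" and lt: "gap_delta M N < r" and r: "r > 0" and u: "u \<in> M"
  shows "\<exists>v\<in>N. norm (u - v) \<le> r * norm u"
proof (cases "u = 0")
  case True
  then show ?thesis using subspace_0[OF N] by (intro bexI[of _ 0]) auto
next
  case False
  \<comment> \<open>As \<open>0\<close> is in \<open>N\<close>, unit vectors have distance at most
    1; the real supremum dominates its members only when they are bounded above.\<close>
  have bdd: "bdd_above ((\<lambda>u. infdist u N) ` {u\<in>M. norm u = 1})"
  proof (rule bdd_aboveI2)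
    fix u assume "u \<in> {u\<in>M. norm u = 1}"
    then show "infdist u N \<le> 1" using infdist_le[OF subspace_0[OF N], of u] by simp
  qed
  define e where "e = (1 / norm u) *\<^sub>R u"
  have e: "e \<in> M" "norm e = 1" using u False M by (auto simp: e_def subspace_scale)
  have "infdist e N \<le> gap_delta M N"
    using u False e bdd by (auto simp: gap_delta_def intro!: cSUP_upper)
  then have "infdist e N < r" using lt by simp
  then obtain v where v: "v \<in> N" "dist e v < r"
    using cINF_less_iff[of N "dist e" r] subspace_0[OF N] bdd_belowI2[of N 0 "dist e"]
    by (auto simp: infdist_def split: if_splits)
  have "u - norm u *\<^sub>R v = norm u *\<^sub>R (e - v)" using False by (simp add: e_def algebra_simps)
  then have "norm (u - norm u *\<^sub>R v) = norm u * dist e v" by (simp add: dist_norm)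
  also have "\<dots> \<le> r * norm u" using mult_left_mono[of "dist e v" r "norm u"] v by (simp add: mult.commute)
  finally show ?thesis using v N by (meson subspace_scale)
qed

text \<open>The zero subspace has no unit vectors and is settled by the separate clause of
  \<open>gap_delta\<close>; otherwise the supremum is over a nonempty set.\<close>

lemma gap_delta_leI:
  assumes M: "subspace M" and r: "r \<ge> 0" and ap: "\<And>u. u \<in> M \<Longrightarrow> norm u = 1 \<Longrightarrow> \<exists>v\<in>N. norm (u - v) \<le> r"
  shows "gap_delta M N \<le> r"
proof (cases "M = {0}")
  case True
  then show ?thesis using r by (simp add: gap_delta_def)
next
  case False
  then obtain x where x: "x \<in> M" "x \<noteq> 0" using subspace_0[OF M] by blast
  have "(1 / norm x) *\<^sub>R x \<in> {u\<in>M. norm u = 1}" using x M by (auto simp: subspace_scale)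
  then have ne: "{u\<in>M. norm u = 1} \<noteq> {}" by blast
  have "infdist u N \<le> r" if "u \<in> M" "norm u = 1" for u
    using ap[OF that] by (metis dist_norm infdist_le order_trans)
  then show ?thesis using False ne by (auto simp: gap_delta_def intro!: cSUP_least)
qed

text \<open>A substitute for the triangle inequality by two successive approximations: the
  intermediate vector has norm at most \<open>1 + r \<le> 2\<close>, so the second error is at most
  \<open>2 * r\<close>.\<close>

lemma gap_delta_weak_triangle:
  assumes L: "subspace L" and M: "subspace M" and N: "subspace N"
    and r: "gap_delta L M < r" "gap_delta M N < r" "0 < r" "r \<le> 1"
  shows "gap_delta L N \<le> 3 * r"
proof (rule gap_delta_leI[OF L])
  fix u assume u: "u \<in> L" "norm u = 1"
  obtain v where v: "v \<in> M" "norm (u - v) \<le> r"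
    using gap_delta_approx[OF L M r(1,3) u(1)] u by auto
  obtain w where w: "w \<in> N" "norm (v - w) \<le> r * norm v"
    using gap_delta_approx[OF M N r(2,3) v(1)] by auto
  have "norm v \<le> norm u + norm (u - v)" using norm_triangle_sub[of v u] by (simp add: norm_minus_commute)
  then have "norm v \<le> 2" using u v r by linarith
  then have "r * norm v \<le> 2 * r" using r by simp
  moreover have "norm (u - w) \<le> norm (u - v) + norm (v - w)"
    using norm_triangle_ineq[of "u - v" "v - w"] by simp
  ultimately have "norm (u - w) \<le> 3 * r" using v w by linarith
  then show "\<exists>v\<in>N. norm (u - v) \<le> 3 * r" using w by blast
qed (use r in auto)

text \<open>
  Gap balls need not be open, as the gap is not a metric. The open set used here is the interior
  of the ball.
\<close>

lemma gap_ball_contains_open: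
  fixes M :: "'c::real_normed_vector set"
  assumes M: "subspace M" "closed M" and r: "r > 0"
  shows "\<exists>U. gap_open U \<and> M \<in> U \<and> (\<forall>N\<in>U. gap M N < r)"
proof -
  define U where "U = {L. subspace L \<and> closed L \<and>
    (\<exists>\<rho>>0. \<forall>N. subspace N \<and> closed N \<and> gap L N < \<rho> \<longrightarrow> gap M N < r)}"
  have refl: "gap L L < \<rho>" if "\<rho> > 0" "subspace L" for L :: "'c set" and \<rho>
  proof -
    have "gap_delta L L \<le> 0" by (rule gap_delta_leI) (use that in auto)
    then show ?thesis using that by (simp add: gap_def)
  qed
  have "gap_open U"
    unfolding gap_open_def
  proof (intro conjI ballI)
    show "U \<subseteq> {M. subspace M \<and> closed M}" by (auto simp: U_def)
    fix L assume "L \<in> U"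
    then obtain \<rho> where L: "subspace L" "closed L" and \<rho>: "\<rho> > 0"
      "\<And>N. subspace N \<Longrightarrow> closed N \<Longrightarrow> gap L N < \<rho> \<Longrightarrow> gap M N < r"
      by (auto simp: U_def)
    \<comment> \<open>The weak triangle inequality needs \<open>\<sigma> \<le> 1\<close>, and its
      bound \<open>3 * \<sigma>\<close> has to stay below \<open>\<rho>\<close>.\<close>
    define \<sigma> where "\<sigma> = min 1 (\<rho> / 4)"
    have \<sigma>: "\<sigma> > 0" "\<sigma> \<le> 1" "3 * \<sigma> < \<rho>" using \<rho> by (auto simp: \<sigma>_def)
    have "L' \<in> U" if L': "subspace L'" "closed L'" "gap L L' < \<sigma>" for L'
    proof -
      have "gap M N < r" if N: "subspace N" "closed N" "gap L' N < \<sigma>" for N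
      proof (rule \<rho>(2)[OF N(1,2)])
        have "gap_delta L N \<le> 3 * \<sigma>" "gap_delta N L \<le> 3 * \<sigma>"
          using L' N L \<sigma> by (auto intro!: gap_delta_weak_triangle[of _ L'] simp: gap_def)
        then show "gap L N < \<rho>" using \<sigma> by (simp add: gap_def)
      qed
      then show ?thesis unfolding U_def using L' \<sigma> by blast
    qed
    then show "\<exists>r>0. \<forall>N. subspace N \<and> closed N \<and> gap L N < r \<longrightarrow> N \<in> U"
      using \<sigma> by blast
  qed
  moreover have "M \<in> U" using M r by (auto simp: U_def)
  moreover have "gap M N < r" if "N \<in> U" for N
  proof -
    from that obtain \<rho> where "subspace N" "closed N" "\<rho> > 0"
      "\<And>K. subspace K \<Longrightarrow> closed K \<Longrightarrow> gap N K < \<rho> \<Longrightarrow> gap M K < r"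
      by (auto simp: U_def)
    then show ?thesis using refl by blast
  qed
  ultimately show ?thesis by blast
qed


section \<open>Stability of bijectivity under small gap\<close>

text \<open>On \<open>M\<close> the map \<open>S\<close> has a bounded inverse by the open mapping
  theorem. Vectors of \<open>M\<close> and \<open>N\<close> approximate each other with small
  relative error, so surjectivity passes to \<open>N\<close> through approximate preimages and the
  lower bound by absorption.\<close>

lemma gap_perturbation_bijective:
  fixes S :: "'a::banach \<Rightarrow> 'b::banach"
  assumes S: "bounded_linear S" and M: "subspace M" "closed M" and W: "closed (S ` M)" "range S \<subseteq> S ` M"
    and inj: "\<And>u. u \<in> M \<Longrightarrow> S u = 0 \<Longrightarrow> u = 0"
  shows "\<exists>r>0. \<exists>C>0. \<forall>N. subspace N \<and> closed N \<and> gap M N < r \<longrightarrow>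
    S ` N = S ` M \<and> (\<forall>u\<in>N. norm u \<le> C * norm (S u))"
proof -
  interpret bounded_linear S by fact
  obtain C where C: "C > 0" "\<And>w. w \<in> S ` M \<Longrightarrow> \<exists>u\<in>M. S u = w \<and> norm u \<le> C * norm w"
    using open_mapping_subspace[OF S M W(1)] by blast
  have CM: "norm u \<le> C * norm (S u)" if "u \<in> M" for u
  proof -
    obtain u' where u': "u' \<in> M" "S u' = S u" "norm u' \<le> C * norm (S u)"
      using C(2)[OF imageI[OF \<open>u \<in> M\<close>]] by blast
    then have "u - u' = 0" using that M by (intro inj) (auto simp: subspace_diff diff)
    then show ?thesis using u' by simp
  qed
  obtain B where B: "B > 0" "\<And>u. norm (S u) \<le> norm u * B" using pos_bounded by blast
  \<comment> \<open>Chosen so that both \<open>r\<close> and \<open>B * C * r\<close> are at most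
    1/4.\<close>
  define r where "r = 1 / (4 * (1 + B * C))"
  have BC: "B * C > 0" using B C by simp
  have r: "r > 0" "r \<le> 1/4" "B * C * r \<le> 1/4"
    using BC by (auto simp: r_def field_simps)
  have "S ` N = S ` M \<and> (\<forall>u\<in>N. norm u \<le> (2 * C) * norm (S u))"
    if N: "subspace N" "closed N" "gap M N < r" for N
  proof
    have MN: "\<exists>v\<in>N. norm (u - v) \<le> r * norm u" if "u \<in> M" for u
      using gap_delta_approx[OF M(1) N(1) _ r(1) that] N(3) by (simp add: gap_def)
    have NM: "\<exists>v\<in>M. norm (u - v) \<le> r * norm u" if "u \<in> N" for u
      using gap_delta_approx[OF N(1) M(1) _ r(1) that] N(3) by (simp add: gap_def)
    \<comment> \<open>Move a preimage in \<open>M\<close> to a nearby vector of \<open>N\<close>: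
      its image changes by at most \<open>B * C * r * norm w\<close>.\<close>
    have "\<exists>u\<in>N. norm u \<le> (2 * C) * norm w \<and> norm (S u - w) \<le> norm w / 2" if "w \<in> S ` M" for w
    proof -
      obtain u where u: "u \<in> M" "S u = w" "norm u \<le> C * norm w" using C(2)[OF \<open>w \<in> S ` M\<close>] by blast
      obtain v where v: "v \<in> N" "norm (u - v) \<le> r * norm u" using MN u by blast
      have "norm (S v - w) \<le> norm (u - v) * B"
        using B(2)[of "v - u"] u by (simp add: diff norm_minus_commute)
      also have "\<dots> \<le> (r * (C * norm w)) * B"
        using v u r B by (intro mult_right_mono) (auto intro: order_trans mult_left_mono)
      also have "\<dots> = (B * C * r) * norm w" by simp
      also have "\<dots> \<le> (1/4) * norm w" using r by (intro mult_right_mono) auto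
      finally have "norm (S v - w) \<le> norm w / 2" using norm_ge_zero[of w] by linarith
      moreover have "norm v \<le> 2 * (C * norm w)"
      proof -
        have "norm v \<le> norm u + norm (u - v)"
          using norm_triangle_sub[of v u] by (simp add: norm_minus_commute)
        moreover have "r * norm u \<le> norm u" using r mult_right_mono[of r 1 "norm u"] by simp
        ultimately show ?thesis using u v by linarith
      qed
      ultimately show ?thesis using v by (metis mult.assoc)
    qed
    moreover have "S ` N \<subseteq> S ` M" using W by blast
    moreover have "subspace (S ` M)"
      using M(1) linear_axioms by (rule linear_subspace_image[rotated])
    ultimately have "\<exists>u\<in>N. S u = w \<and> norm u \<le> 2 * (2 * C) * norm w" if "w \<in> S ` M" for w
      using approximate_preimage_imp_preimage[OF S N(1,2), of "S ` M" "2 * C"] that by simp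
    then show "S ` N = S ` M"
      using \<open>S ` N \<subseteq> S ` M\<close> by (metis imageI subsetI subset_antisym)
    show "\<forall>u\<in>N. norm u \<le> (2 * C) * norm (S u)"
    proof
      \<comment> \<open>The bound on \<open>M\<close>, applied to a nearby \<open>v\<close>, gives
        \<open>norm u \<le> C * norm (S u) + norm u / 2\<close>: one quarter is lost between
        \<open>S u\<close> and \<open>S v\<close>, another between \<open>u\<close> and
        \<open>v\<close>. The half is then absorbed.\<close>
      fix u assume "u \<in> N"
      then obtain v where v: "v \<in> M" "norm (u - v) \<le> r * norm u" using NM by blast
      have "norm (S v) \<le> norm (S u) + norm (S (u - v))"
        using norm_triangle_sub[of "S v" "S u"] by (simp add: diff norm_minus_commute)
      also have "\<dots> \<le> norm (S u) + (r * norm u) * B"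
        using B(2)[of "u - v"] v B(1) mult_right_mono[OF v(2), of B] by linarith
      finally have "norm v \<le> C * (norm (S u) + (r * norm u) * B)"
        using CM[OF v(1)] C(1) by (smt (verit) mult_left_mono)
      also have "\<dots> = C * norm (S u) + (B * C * r) * norm u" by (simp add: algebra_simps)
      also have "\<dots> \<le> C * norm (S u) + (1/4) * norm u" using r by (intro add_left_mono mult_right_mono) auto
      finally have "norm v \<le> C * norm (S u) + (1/4) * norm u" .
      moreover have "norm u \<le> norm v + norm (u - v)" by (rule norm_triangle_sub)
      moreover have "r * norm u \<le> (1/4) * norm u" using r by (intro mult_right_mono) auto
      ultimately show "norm u \<le> (2 * C) * norm (S u)" using v by linarith
    qed
  qed
  then show ?thesis using r(1) C(1) by (intro exI[of _ r] conjI exI[of _ "2 * C"]) auto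
qed

section \<open>Skew-adjoint Fredholm relations\<close>

lemma bounded_bilinear_imp_bilinear: "bounded_bilinear f \<Longrightarrow> bilinear f"
  unfolding bilinear_def
  by (simp add: bounded_linear.linear bounded_bilinear.bounded_linear_left bounded_bilinear.bounded_linear_right)

lemma skew_adjoint_relD:
  assumes "bounded_bilinear \<Omega>" "skew_adjoint_rel \<Omega> A" "(x, y) \<in> A" "(x', y') \<in> A"
  shows "\<Omega> x y' = - \<Omega> x' y"
proof -
  interpret bounded_bilinear \<Omega> by fact
  have "(x', - y') \<in> form_adjoint \<Omega> A"
    using assms(2,4) unfolding skew_adjoint_rel_def by blast
  then have "\<Omega> x (- y') = \<Omega> x' y" using assms(3) by (auto simp: form_adjoint_def)
  then show ?thesis by (simp add: minus_right minus_equation_iff)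
qed

text \<open>Passes from classes in the quotient to representatives: \<open>span B\<close> and
  \<open>W\<close> together fill the space.\<close>

lemma quot_basis_decomp:
  assumes W: "subspace W" and B: "quot_basis W B"
  shows "\<exists>u. y - (\<Sum>b\<in>B. u b *\<^sub>R b) \<in> W"
proof -
  obtain u where "quot_class W y = quot_class W (\<Sum>b\<in>B. u b *\<^sub>R b)"
    using B unfolding quot_basis_def quot_space_def by blast
  moreover have "y \<in> quot_class W y"
    using subspace_0[OF W] by (force simp: quot_class_def)
  ultimately show ?thesis by (intro exI[of _ u]) (auto simp: quot_class_def)
qed

lemma subspace_Range_rel: "subspace A \<Longrightarrow> subspace (Range A)"
  using linear_subspace_image[OF linear_snd, of A] by (simp add: Range_snd)

lemma linear_Pair0: "linear (\<lambda>x. (x, 0))"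
  by (rule linearI) auto

lemma subspace_ker_rel: "subspace A \<Longrightarrow> subspace (ker_rel A)"
  using linear_subspace_vimage[OF linear_Pair0, of A] by (simp add: ker_rel_def vimage_def)

text \<open>Skew symmetry puts the range inside the annihilator of the kernel. Equality is a count
  of dimensions: by nondegeneracy a complement of the range contains a family dual to a basis of the
  kernel, and index 0 makes this family span the complement.\<close>

lemma range_eq_annihilator_ker:
  fixes \<Omega> :: "'a::real_normed_vector \<Rightarrow> 'b::real_normed_vector \<Rightarrow> real"
  assumes \<Omega>: "bounded_bilinear \<Omega>" "nondegenerate \<Omega>"
    and A: "fredholm_rel A" "fredholm_index A = 0" "skew_adjoint_rel \<Omega> A"
  shows "\<exists>I v. finite I \<and> independent I \<and> span I = ker_rel A \<and>
    (\<forall>i\<in>I. \<forall>j\<in>I. \<Omega> i (v j) = (if i = j then 1 else 0)) \<and> Range A = {y. \<forall>i\<in>I. \<Omega> i y = 0}"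
proof -
  interpret bounded_bilinear \<Omega> by fact
  have sA: "subspace A" using A by (simp add: fredholm_rel_def)
  have sR: "subspace (Range A)" by (rule subspace_Range_rel[OF sA])
  have sK: "subspace (ker_rel A)" by (rule subspace_ker_rel[OF sA])
  obtain F where F: "finite F" "span F = ker_rel A" using A by (auto simp: fredholm_rel_def)
  obtain I where I: "I \<subseteq> ker_rel A" "independent I" "ker_rel A \<subseteq> span I" "card I = dim (ker_rel A)"
    using basis_exists by blast
  have spI: "span I = ker_rel A" using I sK by (simp add: span_minimal subset_antisym)
  have finI: "finite I" using independent_span_bound[OF F(1) I(2)] I F by simp
  \<comment> \<open>The same choice as in \<open>quot_dim\<close>, so that \<open>card B\<close> is
    the codimension occurring in the index.\<close>
  define B where "B = (SOME B. quot_basis (Range A) B)"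
  have B: "quot_basis (Range A) B"
    using A unfolding B_def fredholm_rel_def quot_findim_def by (metis someI_ex)
  have finB: "finite B" using B by (simp add: quot_basis_def)
  have cardB: "card B = card I"
    using A(2) I by (simp add: fredholm_index_def quot_dim_def B_def)
  have ann: "\<Omega> x y = 0" if "x \<in> ker_rel A" "y \<in> Range A" for x y
    using that skew_adjoint_relD[OF \<Omega>(1) A(3), of x 0 _ y] by (auto simp: ker_rel_def zero_right)
  have spanB: "(\<Sum>b\<in>B. u b *\<^sub>R b) \<in> span B" for u by (auto intro: span_sum span_scale span_base)
  have "\<exists>v. (\<forall>i\<in>I. v i \<in> span B) \<and> (\<forall>i\<in>I. \<forall>j\<in>I. \<Omega> i (v j) = (if i = j then 1 else 0))"
  proof (rule dual_family_exists[OF bounded_bilinear_imp_bilinear[OF \<Omega>(1)] subspace_span finI I(2)])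
    fix x assume x: "x \<in> span I" "\<forall>y\<in>span B. \<Omega> x y = 0"
    \<comment> \<open>\<open>x\<close> kills the range by \<open>ann\<close> and
      \<open>span B\<close> by assumption, hence everything.\<close>
    have "\<Omega> x y = 0" for y
    proof -
      obtain u where u: "y - (\<Sum>b\<in>B. u b *\<^sub>R b) \<in> Range A" using quot_basis_decomp[OF sR B] by blast
      have "\<Omega> x (y - (\<Sum>b\<in>B. u b *\<^sub>R b)) = 0" using ann u x(1) spI by blast
      then show ?thesis using x(2) spanB by (simp add: diff_right)
    qed
    then show "x = 0" using \<Omega>(2) by (simp add: nondegenerate_def)
  qed
  then obtain v where v: "\<And>i. i \<in> I \<Longrightarrow> v i \<in> span B"
    "\<And>i j. i \<in> I \<Longrightarrow> j \<in> I \<Longrightarrow> \<Omega> i (v j) = (if i = j then 1 else 0)" by blast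
  have pair: "\<Omega> i (\<Sum>j\<in>I. c j *\<^sub>R v j) = c i" if "i \<in> I" for i c
    using that finI by (simp add: sum_right scaleR_right v if_distrib[of "\<lambda>t. _ * t"] cong: if_cong)
  have injv: "inj_on v I" using v(2) by (metis inj_onI zero_neq_one)
  have indv: "independent (v ` I)"
  proof (rule independent_if_scalars_zero)
    show "finite (v ` I)" using finI by simp
    fix c x assume c: "(\<Sum>y\<in>v ` I. c y *\<^sub>R y) = 0" "x \<in> v ` I"
    then obtain i where i: "i \<in> I" "x = v i" by blast
    have "(\<Sum>j\<in>I. c (v j) *\<^sub>R v j) = 0" using c injv by (simp add: sum.reindex)
    then show "c x = 0" using pair[OF i(1), of "\<lambda>j. c (v j)"] i by (simp add: zero_right)
  qed
  \<comment> \<open>Index 0 enters here: \<open>card B = card I\<close>, so the independent family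
    \<open>v\<close> cannot be enlarged inside \<open>span B\<close>.\<close>
  have "span B \<subseteq> span (v ` I)"
  proof -
    obtain D where D: "v ` I \<subseteq> D" "D \<subseteq> span B" "independent D" "span B \<subseteq> span D"
      using maximal_independent_subset_extend[of "v ` I" "span B"] indv v by blast
    have "finite D" "card D \<le> card B" using independent_span_bound[OF finB D(3,2)] by auto
    moreover have "card (v ` I) = card B" using injv cardB by (simp add: card_image)
    ultimately have "v ` I = D" using D(1) by (metis card_seteq)
    then show ?thesis using D by simp
  qed
  have "y \<in> Range A" if y: "\<forall>i\<in>I. \<Omega> i y = 0" for y
  proof -
    obtain u where u: "y - (\<Sum>b\<in>B. u b *\<^sub>R b) \<in> Range A" using quot_basis_decomp[OF sR B] by blast
    define z where "z = (\<Sum>b\<in>B. u b *\<^sub>R b)"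
    have "z \<in> span (v ` I)" using spanB \<open>span B \<subseteq> span (v ` I)\<close> unfolding z_def by blast
    then obtain c where "z = (\<Sum>y\<in>v ` I. c y *\<^sub>R y)" using finI by (auto simp: span_finite)
    then have z: "z = (\<Sum>j\<in>I. c (v j) *\<^sub>R v j)" using injv by (simp add: sum.reindex)
    \<comment> \<open>Pairing with \<open>i\<close> reads off the coefficient of \<open>v i\<close>
      in \<open>z\<close>, and \<open>i\<close> kills both \<open>y\<close> and
      \<open>y - z\<close>.\<close>
    have "c (v i) = 0" if "i \<in> I" for i
    proof -
      have "\<Omega> i (y - z) = 0" using ann u I(1) that unfolding z_def by blast
      then show ?thesis using y that pair[OF that, of "\<lambda>j. c (v j)"] z by (simp add: diff_right)
    qed
    then have "z = 0" using z by simp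
    then show ?thesis using u by (simp add: z_def)
  qed
  then have "Range A = {y. \<forall>i\<in>I. \<Omega> i y = 0}" using ann I(1) by blast
  then show ?thesis using finI I(2) spI v(2) by (intro exI[of _ I] exI[of _ v]) auto
qed


section \<open>Local constancy of the parity\<close>

text \<open>\<open>r\<close> fixes the dimension of \<open>E\<close>, which does not involve
  \<open>g\<close>; \<open>\<epsilon>\<close> makes \<open>g\<close> so close to \<open>f\<close>
  that the duality between kernel and \<open>V\<close> still detects vectors of \<open>V\<close>.
  Both bounds are uniform in \<open>N\<close> and \<open>g\<close>.\<close>

lemma ker_dim_parity_locally_constant:
  fixes f :: "'a::banach \<Rightarrow> 'b::banach \<Rightarrow> real"
  assumes f: "bounded_bilinear f" "nondegenerate f"
    and A: "fredholm_rel A" "fredholm_index A = 0" "skew_adjoint_rel f A"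
  shows "\<exists>r>0. \<exists>\<epsilon>>0. \<forall>N g. subspace N \<and> closed N \<and> gap A N < r \<and> bounded_bilinear g \<and>
    (\<forall>x y. \<bar>g x y - f x y\<bar> \<le> \<epsilon> * norm x * norm y) \<and> skew_adjoint_rel g N \<longrightarrow>
    dim (ker_rel N) mod 2 = dim (ker_rel A) mod 2"
proof -
  interpret f: bounded_bilinear f by fact
  have sA: "subspace A" "closed A" using A by (simp_all add: fredholm_rel_def)
  obtain I v where I: "finite I" "independent I" "span I = ker_rel A"
    and v: "\<And>i j. i \<in> I \<Longrightarrow> j \<in> I \<Longrightarrow> f i (v j) = (if i = j then 1 else 0)"
    and R: "Range A = {y. \<forall>i\<in>I. f i y = 0}"
    using range_eq_annihilator_ker[OF f A] by blast
  define P where "P x = (\<Sum>i\<in>I. f x (v i) *\<^sub>R i)" for x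
  define Q where "Q y = (\<Sum>i\<in>I. f i y *\<^sub>R v i)" for y
  \<comment> \<open>\<open>P\<close> projects onto the kernel, \<open>Q\<close> onto the complement \<open>V\<close> of the range. \<open>S\<close> restricts to
    a bijection from \<open>A\<close> onto the product of kernel and range, and this persists for relations
    near \<open>A\<close>.\<close>
  define S where "S u = (P (fst u), snd u - Q (snd u))" for u
  note sum_delta = if_distrib[of "\<lambda>t. _ * t"] if_distrib[of "\<lambda>t. t * _"]
  have bP: "bounded_linear P"
    unfolding P_def
    by (intro bounded_linear_sum bounded_linear_scaleR_const f.bounded_linear_left)
  have bQ: "bounded_linear Q"
    unfolding Q_def
    by (intro bounded_linear_sum bounded_linear_scaleR_const f.bounded_linear_right)
  have bS: "bounded_linear S"
    unfolding S_def
    by (intro bounded_linear_Pair bounded_linear_sub bounded_linear_compose[OF bP]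
        bounded_linear_compose[OF bQ] bounded_linear_fst bounded_linear_snd)
  interpret P: bounded_linear P by fact
  interpret Q: bounded_linear Q by fact
  interpret S: bounded_linear S by fact
  have P_ker: "P x \<in> ker_rel A" for x
    unfolding P_def I(3)[symmetric] by (intro span_sum span_scale span_base)
  have P_id: "P x = x" if "x \<in> ker_rel A" for x
  proof (rule linear_eq_on[OF P.linear_axioms linear_ident])
    show "x \<in> span I" using that I by simp
    show "P i = i" if "i \<in> I" for i
      using that I(1) v by (simp add: P_def if_distrib[of "\<lambda>t. t *\<^sub>R _"] cong: if_cong)
  qed
  \<comment> \<open>\<open>P\<close> preserves pairings with the \<open>v j\<close>, and
    \<open>Q\<close> those with \<open>I\<close>; the latter puts \<open>y - Q y\<close> in the
    range.\<close>
  have f_P: "f (P x) (v j) = f x (v j)" if "j \<in> I" for x j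
    using that I(1) v by (simp add: P_def f.sum_left f.scaleR_left sum_delta cong: if_cong)
  have f_Q: "f i (Q y) = f i y" if "i \<in> I" for y i
    using that I(1) v by (simp add: Q_def f.sum_right f.scaleR_right sum_delta cong: if_cong)
  have Q_Range: "Q y = 0" if "y \<in> Range A" for y
    using that R by (simp add: Q_def)
  have ker_eq: "ker_rel A = {x. P x = x}"
  proof (intro set_eqI iffI)
    show "x \<in> ker_rel A" if "x \<in> {x. P x = x}" for x using that P_ker[of x] by simp
  qed (simp add: P_id)
  have image: "S ` A = ker_rel A \<times> Range A"
  proof (intro set_eqI iffI)
    fix w assume "w \<in> S ` A"
    then show "w \<in> ker_rel A \<times> Range A"
      using P_ker f_Q R by (auto simp: S_def f.diff_right)
  next
    fix w assume "w \<in> ker_rel A \<times> Range A"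
    then obtain n y x where w: "w = (n, y)" "n \<in> ker_rel A" "(x, y) \<in> A" "y \<in> Range A" by auto
    \<comment> \<open>Adding a kernel vector to \<open>x\<close> leaves \<open>y\<close> unchanged
      and adjusts the first component of \<open>S\<close> to \<open>n\<close>.\<close>
    have "n - P x \<in> ker_rel A"
      using w P_ker subspace_ker_rel[OF sA(1)] by (intro subspace_diff)
    then have "(x, y) + (n - P x, 0) \<in> A"
      using w sA by (intro subspace_add) (auto simp: ker_rel_def)
    moreover have "S ((x, y) + (n - P x, 0)) = w"
      using w P_id P_ker Q_Range by (simp add: S_def P.add P.diff)
    ultimately show "w \<in> S ` A" by (metis imageI)
  qed
  have range_S: "range S \<subseteq> S ` A"
    unfolding image using P_ker f_Q R by (auto simp: S_def f.diff_right)
  have "closed (ker_rel A)"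
    unfolding ker_eq by (intro closed_Collect_eq P.continuous_on continuous_on_id)
  moreover have "closed (Range A)" using A by (simp add: fredholm_rel_def)
  ultimately have closed: "closed (S ` A)" unfolding image by (rule closed_Times)
  have inj: "u = 0" if "u \<in> A" "S u = 0" for u
  proof -
    obtain x y where u: "u = (x, y)" by force
    then have y: "y \<in> Range A" using that by auto
    then have "y = 0" using that Q_Range by (simp add: S_def u zero_prod_def)
    then have "x \<in> ker_rel A" using that u by (simp add: ker_rel_def)
    then have "x = 0" using that P_id by (simp add: S_def u zero_prod_def)
    then show ?thesis using u \<open>y = 0\<close> by (simp add: zero_prod_def)
  qed
  have "\<exists>r>0. \<exists>C>0. \<forall>N. subspace N \<and> closed N \<and> gap A N < r \<longrightarrow>
      S ` N = S ` A \<and> (\<forall>u\<in>N. norm u \<le> C * norm (S u))"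
    by (rule gap_perturbation_bijective[OF bS sA closed range_S]) (rule inj)
  then obtain r C where rC: "r > 0" "C > 0"
    and pert: "\<And>N. subspace N \<Longrightarrow> closed N \<Longrightarrow> gap A N < r \<Longrightarrow>
      S ` N = S ` A \<and> (\<forall>u\<in>N. norm u \<le> C * norm (S u))"
    by (elim exE conjE) simp
  \<comment> \<open>Anticipates the last estimate: for \<open>y\<close> in \<open>V\<close> paired
    to zero with \<open>E\<close>, expansion along the \<open>v i\<close> gives
    \<open>norm y \<le> \<epsilon> * D * norm y\<close>, so \<open>\<epsilon> * D < 1\<close> forces
    \<open>y = 0\<close>.\<close>
  define D where "D = (\<Sum>i\<in>I. C * norm i * norm (v i))"
  have D: "D \<ge> 0" using rC by (auto simp: D_def intro!: sum_nonneg)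
  define \<epsilon> where "\<epsilon> = 1 / (D + 1)"
  have \<epsilon>: "\<epsilon> > 0" "\<epsilon> * D < 1" using D by (auto simp: \<epsilon>_def field_simps)
  have "dim (ker_rel N) mod 2 = dim (ker_rel A) mod 2"
    if N: "subspace N" "closed N" "gap A N < r" and g: "bounded_bilinear g"
      and close: "\<And>x y. \<bar>g x y - f x y\<bar> \<le> \<epsilon> * norm x * norm y" and skew: "skew_adjoint_rel g N" for N g
  proof -
    interpret g: bounded_bilinear g by fact
    have SN: "S ` N = ker_rel A \<times> Range A" and CN: "\<And>u. u \<in> N \<Longrightarrow> norm u \<le> C * norm (S u)"
      using pert[OF N] image by auto
    have injN: "u = w" if "u \<in> N" "w \<in> N" "S u = S w" for u w
      using CN[of "u - w"] that N(1) by (simp add: subspace_diff S.diff)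
    have "0 \<in> Range A" using sA subspace_0 by (metis Range.intros zero_prod_def)
    \<comment> \<open>\<open>t\<close> lifts kernel vectors of \<open>A\<close> to \<open>N\<close>,
      landing in \<open>E\<close> with \<open>P (fst (t n)) = n\<close>.\<close>
    have "\<forall>n\<in>ker_rel A. \<exists>u\<in>N. S u = (n, 0)"
      using SN \<open>0 \<in> Range A\<close> by (metis (no_types, lifting) SigmaI imageE)
    then obtain t where t: "\<And>n. n \<in> ker_rel A \<Longrightarrow> t n \<in> N" "\<And>n. n \<in> ker_rel A \<Longrightarrow> S (t n) = (n, 0)"
      by metis
    have IK: "i \<in> ker_rel A" if "i \<in> I" for i using I(3) span_base[OF that] by simp
    define E where "E = {u\<in>N. Q (snd u) = snd u}"
    have S_E: "S u = (P (fst u), 0)" if "u \<in> E" for u using that by (simp add: E_def S_def)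
    have t_E: "t n \<in> E" if "n \<in> ker_rel A" for n
      using t[OF that] by (simp add: E_def S_def)
    have P_t: "P (fst (t n)) = n" if "n \<in> ker_rel A" for n
      using t[OF that] by (simp add: S_def)
    have sE: "subspace E"
      using N(1) by (auto simp: E_def subspace_def Q.add Q.scaleR Q.zero)
    \<comment> \<open>Supplies the finite spanning set for the corank lemma.\<close>
    have spanE: "E \<subseteq> span (t ` I)"
    proof
      fix u assume u: "u \<in> E"
      define c where "c i = f (fst u) (v i)" for i
      have "S u = (\<Sum>i\<in>I. c i *\<^sub>R S (t i))"
        using S_E[OF u] by (simp add: prod_eq_iff fst_sum snd_sum t IK P_def c_def)
      then have Su: "S u = S (\<Sum>i\<in>I. c i *\<^sub>R t i)" by (simp add: S.sum S.scaleR)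
      have sN: "(\<Sum>i\<in>I. c i *\<^sub>R t i) \<in> N"
        using N(1) t IK by (intro subspace_sum subspace_scale) auto
      have "u \<in> N" using u by (simp add: E_def)
      then have eq: "u = (\<Sum>i\<in>I. c i *\<^sub>R t i)" using sN Su by (rule injN)
      show "u \<in> span (t ` I)"
        by (subst eq, intro span_sum span_scale span_base imageI)
    qed
    have "dim ((\<lambda>u. P (fst u)) ` E) = dim E"
    proof (rule dim_injective_image[OF _ sE])
      show "linear (\<lambda>u :: 'a \<times> 'b. P (fst u))"
        by (rule bounded_linear.linear[OF bounded_linear_compose[OF bP bounded_linear_fst]])
      show "inj_on (\<lambda>u. P (fst u)) E"
        using S_E injN by (intro inj_onI) (auto simp: E_def)
    qed
    moreover have "(\<lambda>u. P (fst u)) ` E = ker_rel A"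
      using P_ker P_t t_E by (force intro!: image_eqI)
    ultimately have dimE: "dim E = dim (ker_rel A)" by simp
    define b where "b u w = g (fst u) (snd w)" for u w :: "'a \<times> 'b"
    have b: "bilinear b"
      using bounded_bilinear.comp[OF g bounded_linear_fst bounded_linear_snd]
      unfolding b_def by (rule bounded_bilinear_imp_bilinear)
    have b_skew: "b u w = - b w u" if "u \<in> N" "w \<in> N" for u w
      using skew_adjoint_relD[OF g skew, of "fst u" "snd u" "fst w" "snd w"] that by (simp add: b_def)
    have "{u\<in>E. \<forall>w\<in>E. b u w = 0} = (\<lambda>x. (x, 0::'b)) ` ker_rel N"
    proof (intro set_eqI iffI)
      fix u assume u: "u \<in> {u\<in>E. \<forall>w\<in>E. b u w = 0}"
      define y where "y = snd u"
      have Qy: "Q y = y" using u by (simp add: E_def y_def)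
      \<comment> \<open>Testing the radical on \<open>t i\<close> gives \<open>g x y = 0\<close> for
        \<open>x = fst (t i)\<close>. As \<open>y\<close> is in \<open>V\<close> and
        \<open>P x = i\<close>, also \<open>f x y = f i y\<close>, so only the difference of
        \<open>g\<close> and \<open>f\<close> remains.\<close>
      have coord: "\<bar>f i y\<bar> \<le> \<epsilon> * (C * norm i) * norm y" if i: "i \<in> I" for i
      proof -
        define x where "x = fst (t i)"
        have "f x y = (\<Sum>j\<in>I. f j y * f x (v j))"
          by (subst Qy[symmetric]) (simp add: Q_def f.sum_right f.scaleR_right)
        also have "\<dots> = (\<Sum>j\<in>I. f j y * f i (v j))"
        proof (rule sum.cong)
          fix j assume "j \<in> I"
          then show "f j y * f x (v j) = f j y * f i (v j)"
            using f_P[of j x] P_t[OF IK[OF i]] by (simp add: x_def)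
        qed simp
        also have "\<dots> = f i (Q y)" by (simp add: Q_def f.sum_right f.scaleR_right)
        finally have "f x y = f i y" by (simp add: Qy)
        moreover have "g x y = 0"
        proof -
          have "b u (t i) = 0" using u t_E[OF IK[OF i]] by blast
          then have "b (t i) u = 0"
            using b_skew[of "t i" u] u t_E[OF IK[OF i]] by (simp add: E_def)
          then show ?thesis by (simp add: b_def x_def y_def)
        qed
        ultimately have "\<bar>f i y\<bar> \<le> \<epsilon> * norm x * norm y" using close[of x y] by simp
        also have "norm x \<le> C * norm i"
          using CN[OF t(1)[OF IK[OF i]]] t(2)[OF IK[OF i]] norm_fst_le[of "fst (t i)" "snd (t i)"]
          by (simp add: x_def)
        finally show ?thesis using \<epsilon> by (simp add: mult_left_mono mult_right_mono)
      qed
      have "norm y \<le> (\<Sum>i\<in>I. \<bar>f i y\<bar> * norm (v i))"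
        by (subst Qy[symmetric], unfold Q_def, rule order_trans[OF norm_sum]) simp
      also have "\<dots> \<le> (\<Sum>i\<in>I. (\<epsilon> * (C * norm i) * norm y) * norm (v i))"
        by (intro sum_mono mult_right_mono coord) auto
      also have "\<dots> = (\<epsilon> * D) * norm y"
        by (simp add: D_def sum_distrib_left sum_distrib_right mult_ac)
      finally have "norm y \<le> (\<epsilon> * D) * norm y" .
      then have "y = 0" using \<epsilon>(2) by (smt (verit) mult_le_cancel_right1 norm_ge_zero norm_eq_zero)
      then have "u = (fst u, 0)" by (simp add: y_def prod_eq_iff)
      moreover from this have "(fst u, 0) \<in> N" using u by (simp add: E_def)
      ultimately show "u \<in> (\<lambda>x. (x, 0)) ` ker_rel N"
        by (intro image_eqI[of _ _ "fst u"]) (simp_all add: ker_rel_def)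
    next
      fix u :: "'a \<times> 'b" assume "u \<in> (\<lambda>x. (x, 0)) ` ker_rel N"
      then have u: "u \<in> E" "snd u = 0" by (auto simp: ker_rel_def E_def Q.zero)
      have "b u w = 0" if "w \<in> E" for w
        using b_skew[of u w] u that by (simp add: E_def b_def g.zero_right)
      then show "u \<in> {u\<in>E. \<forall>w\<in>E. b u w = 0}" using u by blast
    qed
    moreover have "dim ((\<lambda>x. (x, 0::'b)) ` ker_rel N) = dim (ker_rel N)"
      by (rule dim_injective_image[OF linear_Pair0 subspace_ker_rel[OF N(1)]]) (simp add: inj_on_def)
    moreover have "\<exists>k. dim E = dim {u\<in>E. \<forall>w\<in>E. b u w = 0} + 2 * k"
      by (rule skew_form_corank_even[OF b sE finite_imageI[OF I(1)] spanE], rule b_skew)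
        (simp_all add: E_def)
    ultimately show ?thesis using dimE by auto
  qed
  then show ?thesis using rC(1) \<epsilon>(1) by (intro exI[of _ r] conjI exI[of _ \<epsilon>]) auto
qed

section \<open>From local constancy to a connected parameter space\<close>

theorem theorem1p4:
  fixes J :: "'j topology"
    and \<Omega> :: "'j \<Rightarrow> 'a::banach \<Rightarrow> 'b::banach \<Rightarrow> real"
    and T :: "'j \<Rightarrow> ('a \<times> 'b) set"
  assumes "connected_space J"
    and "\<And>s. s \<in> topspace J \<Longrightarrow> bounded_bilinear (\<Omega> s)"
    and "\<And>s. s \<in> topspace J \<Longrightarrow> nondegenerate (\<Omega> s)"
    and "continuous_map J euclidean (\<lambda>s. form_map (\<Omega> s))"
    and "continuous_map J gap_topology T"
    and "\<And>s. s \<in> topspace J \<Longrightarrow> fredholm_rel (T s)"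
    and "\<And>s. s \<in> topspace J \<Longrightarrow> fredholm_index (T s) = 0"
    and "\<And>s. s \<in> topspace J \<Longrightarrow> skew_adjoint_rel (\<Omega> s) (T s)"
  shows "\<forall>s\<in>topspace J. \<forall>t\<in>topspace J.
           dim (ker_rel (T s)) mod 2 = dim (ker_rel (T t)) mod 2"
proof -
  define p where "p s = dim (ker_rel (T s)) mod 2" for s
  have T: "subspace (T s)" "closed (T s)" if "s \<in> topspace J" for s
    using assms(6)[OF that] by (simp_all add: fredholm_rel_def)
  have loc: "\<exists>G. openin J G \<and> s \<in> G \<and> (\<forall>t\<in>G. p t = p s)" if s: "s \<in> topspace J" for s
  proof -
    obtain r \<epsilon> where r: "r > 0" and \<epsilon>: "\<epsilon> > 0"
      and par: "\<And>N g. subspace N \<Longrightarrow> closed N \<Longrightarrow> gap (T s) N < r \<Longrightarrow> bounded_bilinear g \<Longrightarrow>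
        (\<And>x y. \<bar>g x y - \<Omega> s x y\<bar> \<le> \<epsilon> * norm x * norm y) \<Longrightarrow> skew_adjoint_rel g N \<Longrightarrow>
        dim (ker_rel N) mod 2 = dim (ker_rel (T s)) mod 2"
      using ker_dim_parity_locally_constant[OF assms(2,3,6,7,8)[OF s]] by metis
    obtain U where U: "gap_open U" "T s \<in> U" "\<And>N. N \<in> U \<Longrightarrow> gap (T s) N < r"
      using gap_ball_contains_open[OF T[OF s] r] by blast
    \<comment> \<open>Gap continuity controls \<open>T\<close>, norm continuity controls the form;
      the operator norm bound on \<open>form_map\<close> becomes the pointwise bound required by
      \<open>par\<close>.\<close>
    define G where "G = {t\<in>topspace J. T t \<in> U} \<inter>
      {t\<in>topspace J. form_map (\<Omega> t) \<in> ball (form_map (\<Omega> s)) \<epsilon>}"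
    have "openin J G"
      unfolding G_def
      using assms(4,5) U(1) by (intro openin_Int openin_continuous_map_preimage)
        (auto simp: openin_gap_topology)
    moreover have "s \<in> G" using s U \<epsilon> by (simp add: G_def)
    moreover have "p t = p s" if "t \<in> G" for t
    proof -
      have t: "t \<in> topspace J" "gap (T s) (T t) < r" "norm (form_map (\<Omega> t) - form_map (\<Omega> s)) \<le> \<epsilon>"
        using that U by (auto simp: G_def dist_norm norm_minus_commute)
      have "\<bar>\<Omega> t x y - \<Omega> s x y\<bar> \<le> \<epsilon> * norm x * norm y" for x y
      proof -
        define L where "L = form_map (\<Omega> t) - form_map (\<Omega> s)"
        have "\<Omega> t x y - \<Omega> s x y = blinfun_apply (blinfun_apply L x) y"
          using assms(2) s t by (simp add: L_def blinfun.diff_left form_map_apply)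
        then have "\<bar>\<Omega> t x y - \<Omega> s x y\<bar> \<le> norm (blinfun_apply L x) * norm y"
          using norm_blinfun[of "blinfun_apply L x" y] by simp
        also have "\<dots> \<le> (norm L * norm x) * norm y"
          by (intro mult_right_mono norm_blinfun) simp
        also have "\<dots> \<le> (\<epsilon> * norm x) * norm y"
          using t(3) by (intro mult_right_mono) (auto simp: L_def)
        finally show ?thesis .
      qed
      then show ?thesis
        unfolding p_def using T[OF t(1)] t(2) assms(2,8)[OF t(1)] by (intro par) auto
    qed
    ultimately show ?thesis by blast
  qed
  have "p s = p t" if s: "s \<in> topspace J" and t: "t \<in> topspace J" for s t
  proof -
    \<comment> \<open>Local constancy makes all preimages under \<open>p\<close> open. Applied to
      \<open>{p s}\<close> and its complement, this makes the fibre clopen.\<close>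
    have op: "openin J {x\<in>topspace J. p x \<in> K}" for K
    proof (subst openin_subopen, intro ballI)
      fix x assume x: "x \<in> {x\<in>topspace J. p x \<in> K}"
      then have "x \<in> topspace J" "p x \<in> K" by simp_all
      from loc[OF this(1)] obtain G where G: "openin J G" "x \<in> G" "\<forall>t\<in>G. p t = p x"
        by (elim exE conjE)
      have "z \<in> topspace J \<and> p z \<in> K" if "z \<in> G" for z
        using bspec[OF G(3) that] \<open>p x \<in> K\<close> subsetD[OF openin_subset[OF G(1)] that] by simp
      then have "G \<subseteq> {x\<in>topspace J. p x \<in> K}" by blast
      with G(1,2) show "\<exists>G. openin J G \<and> x \<in> G \<and> G \<subseteq> {x\<in>topspace J. p x \<in> K}"
        by (intro exI[of _ G] conjI)
    qed
    have "topspace J - {x\<in>topspace J. p x \<in> {p s}} = {x\<in>topspace J. p x \<in> - {p s}}" by blast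
    then have "closedin J {x\<in>topspace J. p x \<in> {p s}}"
      using op[of "- {p s}"] by (auto simp: closedin_def)
    then have "{x\<in>topspace J. p x \<in> {p s}} = {} \<or> {x\<in>topspace J. p x \<in> {p s}} = topspace J"
      using assms(1) op[of "{p s}"] unfolding connected_space_clopen_in by (elim allE impE) auto
    then have "t \<in> {x\<in>topspace J. p x \<in> {p s}}" using s t by blast
    then show ?thesis by simp
  qed
  then show ?thesis unfolding p_def by (intro ballI)
qed

end
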